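(* Assume (C1): the covariance matrices $\Sigma_x$ and $\Sigma_y$ of $X$ and $Y$ are finite and have full rank $d$. Then the map $h_N^C:\Theta_n\to\mathbb{R}^d$ defined by $$h_N^C(\theta)=\hat\theta+\gamma(N,l(\theta))\,(\theta-\hat\theta),\qquad \gamma(N,l(\theta))=1+\frac{l(\theta)}{2N},$$ satisfies: (i) $h_N^C$ has a unique fixed point, at $\hat\theta$; (ii) for each individual contour $\{\theta\in\Theta_n: l(\theta)=\tau\}$ of $l$, the restriction of $h_N^C$ to that contour is a similarity mapping; (iii) $h_N^C$ is a bijective mapping from $\Theta_n$ to $\mathbb{R}^d$.
   Context: Let $X,Y$ be random vectors in $\mathbb{R}^d$ with means $\mu_x,\mu_y$ and covariance matrices $\Sigma_x,\Sigma_y$. Let $X_1,\dots,X_m$ be independent copies of $X$ and $Y_1,\dots,Y_n$ independent copies of $Y$, all $m+n$ vectors mutually independent, with $m\ge n>d$, and put $N=m+n$. For probability vectors $p=(p_1,\dots,p_m)$ and $q=(q_1,\dots,q_n)$ (nonnegative entries summing to $1$) let $\theta(p,q)=\sum_{j=1}^n q_jY_j-\sum_{i=1}^m p_iX_i$. Let $D_\theta\subset\mathbb{R}^d$ be the set of all values $\theta(p,q)$. The original two-sample empirical log-likelihood ratio (OEL) is $$l(\theta)=-2\max_{(p,q):\,\theta(p,q)=\theta}\Big(\sum_{i=1}^m\log(mp_i)+\sum_{j=1}^n\log(nq_j)\Big),\qquad \theta\in D_\theta,$$ with $\log 0=-\infty$. Its domain is $\Theta_n=\{\theta\in D_\theta: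 l(\theta)<+\infty\}$, i.e. the set of $\theta(p,q)$ with all entries of $p$ and $q$ strictly positive. Standing convention: $\Theta_n$ is an open subset of $\mathbb{R}^d$ (i.e. the samples are not degenerate in the sense that $D_\theta$ has nonempty interior). Let $\hat\theta=\bar Y-\bar X$ with $\bar X=m^{-1}\sum_i X_i$, $\bar Y=n^{-1}\sum_j Y_j$. A similarity mapping is a map $f$ for which there is a constant $r>0$ with $\|f(u)-f(v)\|=r\|u-v\|$ for all $u,v$ in its domain. *)

theory Defs
  imports "HOL-Probability.Probability"
begin

section \<open>Moments of random vectors\<close>

definition cov_matrix :: "'w measure \<Rightarrow> ('w \<Rightarrow> real ^ 'd) \<Rightarrow> real ^ 'd ^ 'd" where
  "cov_matrix M X =
     (\<chi> i j. integral\<^sup>L M (\<lambda>w. (X w $ i - integral\<^sup>L M X $ i) * (X w $ j - integral\<^sup>L M X $ j)))"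

text \<open>Bochner integrals of non-integrable functions are \<open>0\<close>, so the existence of the
  mean and of every covariance entry is a separate condition.\<close>

definition finite_cov :: "'w measure \<Rightarrow> ('w \<Rightarrow> real ^ 'd) \<Rightarrow> bool" where
  "finite_cov M X \<longleftrightarrow> integrable M X \<and>
     (\<forall>i j. integrable M
        (\<lambda>w. (X w $ i - integral\<^sup>L M X $ i) * (X w $ j - integral\<^sup>L M X $ j)))"


section \<open>Two-sample empirical likelihood for the difference of means\<close>

text \<open>Samples and weights are functions on \<open>nat\<close> of which only the values on \<open>{1..m}\<close>
  (for \<open>x\<close>, \<open>p\<close>) and \<open>{1..n}\<close> (for \<open>y\<close>, \<open>q\<close>) matter.\<close>

definition prob_vector :: "nat \<Rightarrow> (nat \<Rightarrow> real) \<Rightarrow> bool" where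
  "prob_vector k p \<longleftrightarrow> (\<forall>i\<in>{1..k}. 0 \<le> p i) \<and> (\<Sum>i=1..k. p i) = 1"

definition theta_pq ::
  "nat \<Rightarrow> nat \<Rightarrow> (nat \<Rightarrow> real ^ 'd) \<Rightarrow> (nat \<Rightarrow> real ^ 'd) \<Rightarrow>
   (nat \<Rightarrow> real) \<Rightarrow> (nat \<Rightarrow> real) \<Rightarrow> real ^ 'd" where
  "theta_pq m n x y p q = (\<Sum>j=1..n. q j *\<^sub>R y j) - (\<Sum>i=1..m. p i *\<^sub>R x i)"

definition D_theta ::
  "nat \<Rightarrow> nat \<Rightarrow> (nat \<Rightarrow> real ^ 'd) \<Rightarrow> (nat \<Rightarrow> real ^ 'd) \<Rightarrow> (real ^ 'd) set" where
  "D_theta m n x y = {theta_pq m n x y p q | p q. prob_vector m p \<and> prob_vector n q}"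

text \<open>The library has \<open>ln 0 = 0\<close>; here \<open>log 0 = -\<infinity>\<close> is needed.\<close>

definition elog :: "real \<Rightarrow> ereal" where
  "elog t = (if 0 < t then ereal (ln t) else - \<infinity>)"

text \<open>The maximum is written as a supremum in \<open>ereal\<close>.  For \<open>\<theta>\<close> in \<open>D_theta m n x y\<close> it is
  attained, the feasible weights forming a nonempty compact set on which the objective is
  upper semicontinuous.\<close>

definition OEL ::
  "nat \<Rightarrow> nat \<Rightarrow> (nat \<Rightarrow> real ^ 'd) \<Rightarrow> (nat \<Rightarrow> real ^ 'd) \<Rightarrow> real ^ 'd \<Rightarrow> ereal" where
  "OEL m n x y \<theta> =
     - 2 * Sup {(\<Sum>i=1..m. elog (real m * p i)) + (\<Sum>j=1..n. elog (real n * q j)) | p q.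
                  prob_vector m p \<and> prob_vector n q \<and> theta_pq m n x y p q = \<theta>}"

definition Theta ::
  "nat \<Rightarrow> nat \<Rightarrow> (nat \<Rightarrow> real ^ 'd) \<Rightarrow> (nat \<Rightarrow> real ^ 'd) \<Rightarrow> (real ^ 'd) set" where
  "Theta m n x y = {\<theta> \<in> D_theta m n x y. OEL m n x y \<theta> < \<infinity>}"

definition theta_hat ::
  "nat \<Rightarrow> nat \<Rightarrow> (nat \<Rightarrow> real ^ 'd) \<Rightarrow> (nat \<Rightarrow> real ^ 'd) \<Rightarrow> real ^ 'd" where
  "theta_hat m n x y = (1 / real n) *\<^sub>R (\<Sum>j=1..n. y j) - (1 / real m) *\<^sub>R (\<Sum>i=1..m. x i)"

definition expansion_factor :: "nat \<Rightarrow> real \<Rightarrow> real" where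
  "expansion_factor N l = 1 + l / (2 * real N)"

text \<open>Only meaningful on \<open>Theta m n x y\<close>, where \<open>OEL\<close> is finite.\<close>

definition h_C ::
  "nat \<Rightarrow> nat \<Rightarrow> (nat \<Rightarrow> real ^ 'd) \<Rightarrow> (nat \<Rightarrow> real ^ 'd) \<Rightarrow> real ^ 'd \<Rightarrow> real ^ 'd" where
  "h_C m n x y \<theta> = theta_hat m n x y +
     expansion_factor (m + n) (real_of_ereal (OEL m n x y \<theta>)) *\<^sub>R (\<theta> - theta_hat m n x y)"

definition similarity_on :: "'a::real_normed_vector set \<Rightarrow> ('a \<Rightarrow> 'b::real_normed_vector) \<Rightarrow> bool"
  where "similarity_on S f \<longleftrightarrow> (\<exists>r>0. \<forall>u\<in>S. \<forall>v\<in>S. norm (f u - f v) = r * norm (u - v))"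

end

theory Submission imports Defs
begin

text \<open>
  For a fixed outcome the theorem is about the convexity and the growth of the log-likelihood ratio
  \<open>l\<close> on the open set \<open>\<Theta>\<close>. The map moves each point along the ray from \<open>theta_hat\<close> through it,
  multiplying its distance from \<open>theta_hat\<close> by \<open>1 + l \<theta> / (2 N)\<close>. This factor is constant on a
  contour of \<open>l\<close>, which gives the similarity. A fixed point is \<open>theta_hat\<close> or a zero of \<open>l\<close>, and
  \<open>theta_hat\<close> is the only zero: weights whose log-likelihood
  is close to the maximal value \<open>0\<close> are close to uniform, so their difference of weighted means is
  close to \<open>theta_hat\<close> (\<open>weight_deviation_bound\<close>, \<open>real_OEL_eq_0_iff\<close>).

  For the bijection, consider one ray. Mixing weights shows that \<open>l\<close> is convex
  (\<open>real_OEL_convex\<close>), hence continuous on the open set \<open>\<Theta>\<close>. It is nonnegative and vanishes at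
  \<open>theta_hat\<close>, so it does not decrease along the ray. The distance of the image from \<open>theta_hat\<close> is
  therefore continuous and strictly increasing on the part of the ray in \<open>\<Theta>\<close>. It takes every nonnegative value
  because \<open>l\<close> is unbounded on the part of the ray in \<open>\<Theta>\<close> whenever the ray leaves \<open>\<Theta>\<close>.

  This last point is usually argued by compactness of the weights. Here it comes from a
  quantitative fact: a bound on \<open>l \<theta>\<close> bounds all weights of some representation of \<open>\<theta>\<close> away from
  \<open>0\<close> (\<open>weight_lower_bound\<close>), so these weights can absorb a perturbation that moves \<open>\<theta>\<close> by a scaled
  copy of any vector in a fixed ball. The ball can be taken from \<open>\<Theta>\<close> being a neighbourhood of
  \<open>theta_hat\<close>. Hence all points of a sublevel set of \<open>l\<close> have the same positive margin inside \<open>\<Theta>\<close>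
  (\<open>real_OEL_sublevel_margin\<close>).
\<close>

section \<open>Radial expansions of a convex domain\<close>

lemma convex_on_along_ray:
  fixes l :: "'a::real_vector \<Rightarrow> real"
  assumes conv: "convex_on S l" and c: "c \<in> S" "l c = 0"
    and u: "c + u \<in> S" and s: "0 \<le> s" "s \<le> 1"
  shows "c + s *\<^sub>R u \<in> S" and "l (c + s *\<^sub>R u) \<le> s * l (c + u)"
proof -
  have eq: "c + s *\<^sub>R u = (1 - s) *\<^sub>R c + s *\<^sub>R (c + u)"
    by (simp add: algebra_simps)
  have "convex S"
    using conv by (simp add: convex_on_def)
  then show "c + s *\<^sub>R u \<in> S"
    unfolding eq using c(1) u s by (intro convexD) auto
  show "l (c + s *\<^sub>R u) \<le> s * l (c + u)"
    unfolding eq using convex_onD[OF conv s c(1) u] c(2) by simp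
qed

text \<open>
  The hypothesis on balls is a form of \<open>l\<close> tending to infinity at the boundary of \<open>S\<close>: a sublevel
  set keeps a uniform distance from the complement of \<open>S\<close>. Without it \<open>l = 0\<close> would be
  possible, and the map the identity, on a proper subset \<open>S\<close>. Injectivity is the monotonicity of
  \<open>l\<close> along rays; surjectivity is the intermediate value theorem on the ray through the target.
\<close>

lemma radial_expansion_bij:
  fixes l :: "'a::euclidean_space \<Rightarrow> real"
  assumes "open S" and conv: "convex_on S l"
    and c: "c \<in> S" "l c = 0" and nonneg: "\<And>u. u \<in> S \<Longrightarrow> 0 \<le> l u"
    and margin: "\<And>L. \<exists>\<delta>>0. \<forall>u\<in>S. l u \<le> L \<longrightarrow> ball u \<delta> \<subseteq> S"
    and "0 < k"
  shows "bij_betw (\<lambda>u. c + (1 + k * l u) *\<^sub>R (u - c)) S UNIV"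
proof -
  define h where "h = (\<lambda>u. c + (1 + k * l u) *\<^sub>R (u - c))"
  have eq_if: "u = v" if uv: "u \<in> S" "v \<in> S" "h u = h v" and le: "l u \<le> l v" for u v
  proof -
    \<comment> \<open>Equal images force \<open>v - c = s *\<^sub>R (u - c)\<close>, with \<open>s \<le> 1\<close> because \<open>l u \<le> l v\<close>; convexity then
      gives the opposite inequality.\<close>
    define s where "s = (1 + k * l u) / (1 + k * l v)"
    have pos: "0 < 1 + k * l u" "0 < 1 + k * l v"
      using nonneg uv \<open>0 < k\<close> by (simp_all add: add_pos_nonneg)
    have s: "0 \<le> s" "s \<le> 1"
      using pos le \<open>0 < k\<close> by (simp_all add: s_def)
    have "(1 + k * l v) *\<^sub>R (v - c) = (1 + k * l u) *\<^sub>R (u - c)"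
      using uv(3) by (simp add: h_def)
    then have "(1 / (1 + k * l v)) *\<^sub>R ((1 + k * l v) *\<^sub>R (v - c)) = s *\<^sub>R (u - c)"
      by (simp add: s_def)
    then have "v - c = s *\<^sub>R (u - c)"
      using pos by simp
    then have v: "v = c + s *\<^sub>R (u - c)"
      by (metis add.commute diff_add_cancel)
    have "l v \<le> s * l u"
      using convex_on_along_ray(2)[OF conv c, of "u - c" s] s uv(1) v by simp
    also have "\<dots> \<le> l u"
      using mult_right_mono[OF s(2) nonneg[OF uv(1)]] by simp
    finally have "s = 1"
      using le pos by (simp add: s_def)
    then show ?thesis
      using v by simp
  qed
  have "inj_on h S"
    by (intro inj_onI) (metis eq_if linear)
  moreover have "z \<in> h ` S" for z
  proof -
    define v where "v = z - c"
    define g where "g = (\<lambda>t. t * (1 + k * l (c + t *\<^sub>R v)))"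
    have h_ray: "h (c + t *\<^sub>R v) = c + g t *\<^sub>R v" for t
      by (simp add: h_def g_def mult.commute)
    \<comment> \<open>The ray is parametrised so that the target \<open>z\<close> is hit where \<open>g t = 1\<close>. Since the map expands,
      \<open>t \<le> 1\<close> is enough.\<close>
    define A where "A = {t. 0 \<le> t \<and> t \<le> 1 \<and> c + t *\<^sub>R v \<in> S}"
    have "\<exists>t\<in>A. 1 \<le> g t"
    proof (rule ccontr)
      assume "\<not> (\<exists>t\<in>A. 1 \<le> g t)"
      \<comment> \<open>If \<open>g\<close> stayed below \<open>1\<close>, \<open>l\<close> would be bounded along the ray away from \<open>c\<close>, and the uniform
        margin would allow steps of a fixed length, forever, within \<open>t \<le> 1\<close>.\<close>
      then have small: "g t < 1" if "t \<in> A" for t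
        using that by force
      have notin: "1 \<notin> A"
      proof
        assume "1 \<in> A"
        then have "0 \<le> k * l (c + v)"
          using nonneg[of "c + v"] \<open>0 < k\<close> by (simp add: A_def)
        then show False
          using small[OF \<open>1 \<in> A\<close>] by (simp add: g_def)
      qed
      \<comment> \<open>The step is divided by \<open>1 + norm v\<close> so as to have no case distinction for \<open>v = 0\<close>. A step
        past \<open>1\<close> would pass through \<open>1\<close>, which is not in \<open>A\<close>.\<close>
      have step: "t + r / (1 + norm v) \<in> A"
        if t: "t \<in> A" and r: "0 \<le> r" "r < \<delta>" and ball: "ball (c + t *\<^sub>R v) \<delta> \<subseteq> S" for t r \<delta>
      proof -
        have in_S: "c + (t + a) *\<^sub>R v \<in> S" if "0 \<le> a" "a \<le> r / (1 + norm v)" for a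
        proof -
          have "a * norm v \<le> r / (1 + norm v) * (1 + norm v)"
            using that r by (intro mult_mono) auto
          also have "\<dots> = r"
            using norm_ge_zero[of v] by (simp add: add_nonneg_eq_0_iff)
          finally have "dist (c + t *\<^sub>R v) (c + (t + a) *\<^sub>R v) < \<delta>"
            using that r by (simp add: dist_norm algebra_simps)
          then show ?thesis
            using ball by auto
        qed
        show ?thesis
        proof (cases "t + r / (1 + norm v) \<le> 1")
          case True
          then show ?thesis
            using in_S[of "r / (1 + norm v)"] t r by (auto simp: A_def)
        next
          case False
          then show ?thesis
            using in_S[of "1 - t"] t notin by (auto simp: A_def)
        qed
      qed
      have "0 \<in> A"
        using c by (simp add: A_def)
      obtain \<epsilon> where \<epsilon>: "0 < \<epsilon>" "ball c \<epsilon> \<subseteq> S"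
        using \<open>open S\<close> c open_contains_ball by blast
      \<comment> \<open>The bound \<open>g t < 1\<close> gives \<open>l < 1 / (k t)\<close>, so a positive starting parameter is needed for a
        single bound on \<open>l\<close>.\<close>
      define t0 where "t0 = \<epsilon> / 2 / (1 + norm v)"
      have t0: "t0 \<in> A" "0 < t0"
        using step[OF \<open>0 \<in> A\<close>, of "\<epsilon> / 2" \<epsilon>] \<epsilon> by (auto simp: t0_def add_pos_nonneg)
      obtain \<delta> where \<delta>: "0 < \<delta>" "\<And>u. u \<in> S \<Longrightarrow> l u \<le> 1 / (k * t0) \<Longrightarrow> ball u \<delta> \<subseteq> S"
        using margin by blast
      define d where "d = \<delta> / 2 / (1 + norm v)"
      have "0 < d"
        using \<delta>(1) by (simp add: d_def add_pos_nonneg)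
      have advance: "t + d \<in> A" if t: "t \<in> A" "t0 \<le> t" for t
      proof -
        have in_S: "c + t *\<^sub>R v \<in> S"
          using t by (simp add: A_def)
        have "t0 * (k * l (c + t *\<^sub>R v)) \<le> t * (k * l (c + t *\<^sub>R v))"
          using t t0 \<open>0 < k\<close> nonneg[OF in_S] by (intro mult_right_mono) auto
        also have "\<dots> \<le> 1"
          using small[OF t(1)] t0 t(2) by (simp add: g_def algebra_simps)
        finally have "l (c + t *\<^sub>R v) \<le> 1 / (k * t0)"
          using t0 \<open>0 < k\<close> by (simp add: field_simps)
        then have "ball (c + t *\<^sub>R v) \<delta> \<subseteq> S"
          using \<delta>(2) in_S by blast
        from step[OF t(1) _ _ this, of "\<delta> / 2"] show ?thesis
          using \<delta>(1) by (simp add: d_def)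
      qed
      have "t0 + real i * d \<in> A" for i :: nat
      proof (induction i)
        case 0
        then show ?case
          using t0 by simp
      next
        case (Suc i)
        from advance[OF this] show ?case
          using \<open>0 < d\<close> by (simp add: algebra_simps)
      qed
      moreover obtain i :: nat where "1 < real i * d"
        using \<open>0 < d\<close> reals_Archimedean3 by blast
      ultimately have "t0 + real i * d \<le> 1" "1 < real i * d"
        by (auto simp: A_def)
      then show False
        using t0(2) by linarith
    qed
    then obtain t1 where t1: "t1 \<in> A" "1 \<le> g t1"
      by blast
    have segment: "c + t *\<^sub>R v \<in> S" if t: "0 \<le> t" "t \<le> t1" for t
    proof (cases "t1 = 0")
      case True
      then show ?thesis
        using t c by simp
    next
      case False
      then have "0 < t1"
        using t1 by (simp add: A_def)
      then have "c + (t / t1) *\<^sub>R (t1 *\<^sub>R v) \<in> S"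
        using t t1(1) convex_on_along_ray(1)[OF conv c, of "t1 *\<^sub>R v" "t / t1"]
        by (simp add: A_def)
      then show ?thesis
        using \<open>0 < t1\<close> by simp
    qed
    have "continuous_on S l"
      using convex_on_continuous[OF \<open>open S\<close> conv] .
    then have "continuous_on {0..t1} (\<lambda>t. l (c + t *\<^sub>R v))"
      by (rule continuous_on_compose2) (auto intro!: continuous_intros segment)
    then have "continuous_on {0..t1} g"
      unfolding g_def by (intro continuous_intros)
    moreover have "0 \<le> t1" "g 0 \<le> 1"
      using t1(1) by (simp_all add: A_def g_def)
    ultimately obtain t where t: "0 \<le> t" "t \<le> t1" "g t = 1"
      using IVT'[of g 0 1 t1] t1(2) by blast
    have "h (c + t *\<^sub>R v) = z"
      unfolding h_ray t(3) by (simp add: v_def)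
    then show ?thesis
      using segment[OF t(1,2)] by (metis imageI)
  qed
  ultimately show ?thesis
    unfolding bij_betw_def h_def by blast
qed


section \<open>Strictly positive weights and their log-likelihood\<close>

definition pos_weights :: "nat \<Rightarrow> (nat \<Rightarrow> real) \<Rightarrow> bool" where
  "pos_weights k p \<longleftrightarrow> (\<forall>i\<in>{1..k}. 0 < p i) \<and> (\<Sum>i=1..k. p i) = 1"

definition log_ratio :: "nat \<Rightarrow> (nat \<Rightarrow> real) \<Rightarrow> real" where
  "log_ratio k p = (\<Sum>i=1..k. ln (real k * p i))"

lemma pos_weights_uniform: "0 < k \<Longrightarrow> pos_weights k (\<lambda>_. 1 / real k)"
  by (simp add: pos_weights_def)

lemma log_ratio_uniform: "0 < k \<Longrightarrow> log_ratio k (\<lambda>_. 1 / real k) = 0"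
  by (simp add: log_ratio_def)

lemma pos_weights_convex:
  assumes p: "pos_weights k p" "pos_weights k p'" and s: "0 \<le> s" "s \<le> 1"
  shows "pos_weights k (\<lambda>i. (1 - s) * p i + s * p' i)"
proof -
  have "0 < (1 - s) * p i + s * p' i" if "i \<in> {1..k}" for i
    using convexD[of "{0<..}" "p i" "p' i" "1 - s" s] p s that
    by (auto simp: pos_weights_def convex_real_interval)
  moreover have "(\<Sum>i=1..k. (1 - s) * p i + s * p' i) = 1"
    using p by (simp add: pos_weights_def sum.distrib flip: sum_distrib_left)
  ultimately show ?thesis
    by (simp add: pos_weights_def)
qed

lemma log_ratio_concave:
  assumes p: "pos_weights k p" "pos_weights k p'" and s: "0 \<le> s" "s \<le> 1"
  shows "(1 - s) * log_ratio k p + s * log_ratio k p'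
    \<le> log_ratio k (\<lambda>i. (1 - s) * p i + s * p' i)"
proof -
  have "(1 - s) * ln (real k * p i) + s * ln (real k * p' i)
      \<le> ln (real k * ((1 - s) * p i + s * p' i))" if i: "i \<in> {1..k}" for i
  proof -
    have "0 < real k * p i" "0 < real k * p' i"
      using p i by (auto simp: pos_weights_def)
    then show ?thesis
      using concave_onD[OF ln_concave s, of "real k * p i" "real k * p' i"]
      by (simp add: algebra_simps)
  qed
  then show ?thesis
    unfolding log_ratio_def by (auto simp: sum_distrib_left simp flip: sum.distrib intro!: sum_mono)
qed

lemma pos_weight_le_1: "pos_weights k p \<Longrightarrow> i \<in> {1..k} \<Longrightarrow> p i \<le> 1"
  using member_le_sum[of i "{1..k}" p] by (auto simp: pos_weights_def less_imp_le)

text \<open>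
  Since the \<open>k * p i\<close> average to \<open>1\<close>, the log-likelihood is minus the sum of the defects
  \<open>t - 1 - ln t\<close> at \<open>t = k * p i\<close>. All defects are nonnegative, so each one is at most the sum.
  Every bound on single weights below comes from this.
\<close>

lemma log_defect_le:
  assumes p: "pos_weights k p" and i: "i \<in> {1..k}"
  shows "real k * p i - 1 - ln (real k * p i) \<le> - log_ratio k p"
proof -
  have "real k * p i - 1 - ln (real k * p i)
      \<le> (\<Sum>i=1..k. real k * p i - 1 - ln (real k * p i))"
    using p i by (intro member_le_sum) (auto simp: pos_weights_def intro!: ln_le_minus_one)
  also have "\<dots> = - log_ratio k p"
    using p by (simp add: log_ratio_def pos_weights_def sum_subtractf flip: sum_distrib_left)
  finally show ?thesis .
qed

lemma log_ratio_nonpos: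
  assumes p: "pos_weights k p" and "0 < k"
  shows "log_ratio k p \<le> 0"
proof -
  have "1 \<in> {1..k}" "0 < real k * p 1"
    using p \<open>0 < k\<close> by (auto simp: pos_weights_def)
  then show ?thesis
    using log_defect_le[OF p, of 1] ln_le_minus_one[of "real k * p 1"] by linarith
qed

lemma weight_lower_bound:
  assumes p: "pos_weights k p" and i: "i \<in> {1..k}"
  shows "exp (log_ratio k p - 1) \<le> real k * p i"
proof -
  have pos: "0 < real k * p i"
    using p i by (auto simp: pos_weights_def)
  then have "log_ratio k p - 1 \<le> ln (real k * p i)"
    using log_defect_le[OF p i] by linarith
  then show ?thesis
    using pos by (simp add: ln_ge_iff)
qed

text \<open>
  Applying \<open>ln u \<le> u - 1\<close> to \<open>u = sqrt t\<close> bounds the defect below by \<open>(sqrt t - 1)\<^sup>2\<close>, which is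
  comparable to \<open>(t - 1)\<^sup>2\<close> for bounded \<open>t\<close>.
\<close>

lemma square_le_log_defect:
  fixes t :: real
  assumes "0 < t" "t \<le> K"
  shows "(t - 1)\<^sup>2 \<le> (1 + sqrt K)\<^sup>2 * (t - 1 - ln t)"
proof -
  have t: "t = sqrt t * sqrt t"
    using assms by simp
  have "ln t = 2 * ln (sqrt t)"
    using assms by (simp add: ln_sqrt)
  also have "\<dots> \<le> 2 * (sqrt t - 1)"
    using assms ln_le_minus_one[of "sqrt t"] by simp
  finally have defect: "(sqrt t - 1)\<^sup>2 \<le> t - 1 - ln t"
    using assms by (simp add: power2_diff)
  have "(t - 1)\<^sup>2 = (1 + sqrt t)\<^sup>2 * (sqrt t - 1)\<^sup>2"
    unfolding power_mult_distrib[symmetric] using t by (simp add: algebra_simps)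
  also have "\<dots> \<le> (1 + sqrt K)\<^sup>2 * (t - 1 - ln t)"
    using assms defect by (intro mult_mono power_mono) auto
  finally show ?thesis .
qed

text \<open>A quantitative form of the fact that only uniform weights attain log-likelihood \<open>0\<close>. It
  replaces the attainment of the maximum, as it applies to weights that are only nearly optimal.\<close>

lemma weight_deviation_bound:
  assumes p: "pos_weights k p" and i: "i \<in> {1..k}"
  shows "\<bar>p i - 1 / real k\<bar> \<le> (1 + sqrt (real k)) * sqrt (- log_ratio k p)"
proof -
  have k: "1 \<le> real k"
    using i by auto
  have t: "0 < real k * p i" "real k * p i \<le> real k"
    using p i pos_weight_le_1[OF p i] by (auto simp: pos_weights_def)
  have "(real k * p i - 1)\<^sup>2 \<le> (1 + sqrt (real k))\<^sup>2 * (- log_ratio k p)"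
    using square_le_log_defect[OF t] mult_left_mono[OF log_defect_le[OF p i], of "(1 + sqrt (real k))\<^sup>2"]
    by simp
  then have "sqrt ((real k * p i - 1)\<^sup>2) \<le> sqrt ((1 + sqrt (real k))\<^sup>2 * (- log_ratio k p))"
    by (rule real_sqrt_le_mono)
  then have "\<bar>real k * p i - 1\<bar> \<le> (1 + sqrt (real k)) * sqrt (- log_ratio k p)"
    unfolding real_sqrt_mult by simp
  moreover have "real k * p i - 1 = real k * (p i - 1 / real k)"
    using k by (simp add: right_diff_distrib)
  then have "\<bar>real k * p i - 1\<bar> = real k * \<bar>p i - 1 / real k\<bar>"
    by (simp add: abs_mult)
  moreover have "1 * \<bar>p i - 1 / real k\<bar> \<le> real k * \<bar>p i - 1 / real k\<bar>"
    using k by (intro mult_right_mono) auto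
  ultimately show ?thesis
    by simp
qed


section \<open>The likelihood ratio as a real infimum over positive weights\<close>

definition feasible ::
  "nat \<Rightarrow> nat \<Rightarrow> (nat \<Rightarrow> real ^ 'd) \<Rightarrow> (nat \<Rightarrow> real ^ 'd) \<Rightarrow> real ^ 'd \<Rightarrow>
   (nat \<Rightarrow> real) \<Rightarrow> (nat \<Rightarrow> real) \<Rightarrow> bool" where
  "feasible m n x y \<theta> p q \<longleftrightarrow>
     pos_weights m p \<and> pos_weights n q \<and> theta_pq m n x y p q = \<theta>"

abbreviation real_OEL ::
  "nat \<Rightarrow> nat \<Rightarrow> (nat \<Rightarrow> real ^ 'd) \<Rightarrow> (nat \<Rightarrow> real ^ 'd) \<Rightarrow> real ^ 'd \<Rightarrow> real" where
  "real_OEL m n x y \<theta> \<equiv> real_of_ereal (OEL m n x y \<theta>)"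

lemma sum_elog:
  "finite A \<Longrightarrow> (\<Sum>i\<in>A. elog (f i)) =
     (if \<forall>i\<in>A. 0 < f i then ereal (\<Sum>i\<in>A. ln (f i)) else - \<infinity>)"
  by (induction A rule: finite_induct) (auto simp: elog_def)

lemma sum_elog_weights:
  assumes "prob_vector k p"
  shows "(\<Sum>i=1..k. elog (real k * p i)) =
     (if pos_weights k p then ereal (log_ratio k p) else - \<infinity>)"
  using assms
  by (auto simp: sum_elog pos_weights_def prob_vector_def log_ratio_def zero_less_mult_iff)

lemma pos_weights_prob_vector: "pos_weights k p \<Longrightarrow> prob_vector k p"
  by (auto simp: pos_weights_def prob_vector_def less_imp_le)

text \<open>
  A zero weight contributes \<open>- \<infinity>\<close>, which never raises a supremum, so only positive weights count
  once there are any. The real supremum is then over a nonempty set bounded above by \<open>0\<close>.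
\<close>

lemma OEL_eq_ereal:
  fixes x y :: "nat \<Rightarrow> real ^ 'd"
  assumes "0 < m" "0 < n"
  defines "R \<equiv> \<lambda>\<theta>. {log_ratio m p + log_ratio n q | p q. feasible m n x y \<theta> p q}"
  shows "\<theta> \<in> Theta m n x y \<longleftrightarrow> R \<theta> \<noteq> {}"
    and "R \<theta> \<noteq> {} \<Longrightarrow> OEL m n x y \<theta> = ereal (- 2 * Sup (R \<theta>))"
    and "bdd_above (R \<theta>)"
proof -
  define E where "E = {(\<Sum>i=1..m. elog (real m * p i)) + (\<Sum>j=1..n. elog (real n * q j)) | p q.
                  prob_vector m p \<and> prob_vector n q \<and> theta_pq m n x y p q = \<theta>}"
  have OEL: "OEL m n x y \<theta> = - 2 * Sup E"
    by (simp add: OEL_def E_def)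
  have sub: "E \<subseteq> insert (- \<infinity>) (ereal ` R \<theta>)"
  proof
    fix e assume "e \<in> E"
    then obtain p q where pq: "prob_vector m p" "prob_vector n q" "theta_pq m n x y p q = \<theta>"
      and e: "e = (\<Sum>i=1..m. elog (real m * p i)) + (\<Sum>j=1..n. elog (real n * q j))"
      unfolding E_def by blast
    show "e \<in> insert (- \<infinity>) (ereal ` R \<theta>)"
    proof (cases "pos_weights m p \<and> pos_weights n q")
      case True
      then have "log_ratio m p + log_ratio n q \<in> R \<theta>"
        using pq(3) unfolding R_def feasible_def by blast
      moreover have "e = ereal (log_ratio m p + log_ratio n q)"
        using True pq by (simp only: e sum_elog_weights) simp
      ultimately show ?thesis
        by blast
    next
      case False
      then have "e = - \<infinity>"
        using pq by (simp only: e sum_elog_weights) auto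
      then show ?thesis
        by simp
    qed
  qed
  have sup: "ereal ` R \<theta> \<subseteq> E"
  proof
    fix e assume "e \<in> ereal ` R \<theta>"
    then obtain p q where pq: "feasible m n x y \<theta> p q" "e = ereal (log_ratio m p + log_ratio n q)"
      unfolding R_def by blast
    then have "e = (\<Sum>i=1..m. elog (real m * p i)) + (\<Sum>j=1..n. elog (real n * q j))"
      by (simp only: feasible_def sum_elog_weights pos_weights_prob_vector) simp
    then show "e \<in> E"
      using pq pos_weights_prob_vector unfolding E_def feasible_def by blast
  qed
  have Sup_E: "Sup E = Sup (ereal ` R \<theta>)"
    using Sup_subset_mono[OF sub] Sup_subset_mono[OF sup] by (simp add: sup_bot_left flip: bot_ereal_def)
  have nonpos: "r \<le> 0" if "r \<in> R \<theta>" for r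
    using that log_ratio_nonpos[OF _ assms(1)] log_ratio_nonpos[OF _ assms(2)]
    unfolding R_def feasible_def by (auto intro!: add_nonpos_nonpos)
  then show bdd: "bdd_above (R \<theta>)"
    by (auto simp: bdd_above_def)
  show fin: "OEL m n x y \<theta> = ereal (- 2 * Sup (R \<theta>))" if ne: "R \<theta> \<noteq> {}"
  proof -
    obtain r where r: "r \<in> R \<theta>"
      using ne by blast
    have "ereal r \<le> Sup (ereal ` R \<theta>)" "Sup (ereal ` R \<theta>) \<le> ereal 0"
      using r nonpos by (auto intro!: Sup_upper Sup_least)
    then have "\<bar>Sup (ereal ` R \<theta>)\<bar> \<noteq> \<infinity>"
      by (cases "Sup (ereal ` R \<theta>)") auto
    then have "ereal (Sup (R \<theta>)) = Sup (ereal ` R \<theta>)"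
      by (rule ereal_Sup)
    then have "OEL m n x y \<theta> = - 2 * ereal (Sup (R \<theta>))"
      unfolding OEL Sup_E by simp
    then show ?thesis
      by simp
  qed
  show "\<theta> \<in> Theta m n x y \<longleftrightarrow> R \<theta> \<noteq> {}"
  proof
    assume "\<theta> \<in> Theta m n x y"
    then have "OEL m n x y \<theta> < \<infinity>"
      by (simp add: Theta_def)
    then show "R \<theta> \<noteq> {}"
      unfolding OEL Sup_E by (auto simp: bot_ereal_def)
  next
    assume ne: "R \<theta> \<noteq> {}"
    then have "\<theta> \<in> D_theta m n x y"
      using pos_weights_prob_vector unfolding R_def feasible_def D_theta_def by blast
    then show "\<theta> \<in> Theta m n x y"
      using fin[OF ne] by (simp add: Theta_def)
  qed
qed

lemma feasible_in_Theta:
  assumes "0 < m" "0 < n" "feasible m n x y \<theta> p q"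
  shows "\<theta> \<in> Theta m n x y"
  using OEL_eq_ereal(1)[OF assms(1,2)] assms(3) by blast

text \<open>The next two facts characterise \<open>l \<theta>\<close> as an infimum; all further properties are derived from
  them by choosing weights.\<close>

lemma real_OEL_le:
  assumes mn: "0 < m" "0 < n" and pq: "feasible m n x y \<theta> p q"
  shows "real_OEL m n x y \<theta> \<le> - 2 * (log_ratio m p + log_ratio n q)"
proof -
  let ?R = "{log_ratio m p + log_ratio n q | p q. feasible m n x y \<theta> p q}"
  have "log_ratio m p + log_ratio n q \<le> Sup ?R"
    using pq by (intro cSup_upper OEL_eq_ereal(3)[OF mn]) blast
  moreover have "OEL m n x y \<theta> = ereal (- 2 * Sup ?R)"
    using pq by (intro OEL_eq_ereal(2)[OF mn]) blast
  ultimately show ?thesis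
    by simp
qed

lemma near_optimal_weights:
  assumes mn: "0 < m" "0 < n" and \<theta>: "\<theta> \<in> Theta m n x y" and "0 < e"
  obtains p q where "feasible m n x y \<theta> p q"
    and "- 2 * (log_ratio m p + log_ratio n q) < real_OEL m n x y \<theta> + e"
proof -
  let ?R = "{log_ratio m p + log_ratio n q | p q. feasible m n x y \<theta> p q}"
  have ne: "?R \<noteq> {}"
    using \<theta> OEL_eq_ereal(1)[OF mn] by blast
  then obtain r where r: "r \<in> ?R" "Sup ?R - e / 2 < r"
    using less_cSupE[of "Sup ?R - e / 2" ?R] \<open>0 < e\<close> by auto
  moreover have "OEL m n x y \<theta> = ereal (- 2 * Sup ?R)"
    using ne by (intro OEL_eq_ereal(2)[OF mn])
  ultimately show thesis
    using that by force
qed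

lemma real_OEL_nonneg:
  assumes mn: "0 < m" "0 < n" and \<theta>: "\<theta> \<in> Theta m n x y"
  shows "0 \<le> real_OEL m n x y \<theta>"
proof (rule field_le_epsilon)
  fix e :: real assume "0 < e"
  then obtain p q where pq: "feasible m n x y \<theta> p q"
    "- 2 * (log_ratio m p + log_ratio n q) < real_OEL m n x y \<theta> + e"
    using near_optimal_weights[OF mn \<theta>] by blast
  then have "log_ratio m p \<le> 0" "log_ratio n q \<le> 0"
    using mn log_ratio_nonpos by (auto simp: feasible_def)
  then show "0 \<le> real_OEL m n x y \<theta> + e"
    using pq(2) by argo
qed


section \<open>Geometry of the likelihood ratio\<close>

lemma theta_pq_uniform: "theta_pq m n x y (\<lambda>_. 1 / real m) (\<lambda>_. 1 / real n) = theta_hat m n x y"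
  by (simp add: theta_pq_def theta_hat_def scaleR_sum_right)

lemma theta_pq_add: "theta_pq m n x y (\<lambda>i. p i + p' i) (\<lambda>j. q j + q' j)
    = theta_pq m n x y p q + theta_pq m n x y p' q'"
  by (simp add: theta_pq_def scaleR_add_left sum.distrib algebra_simps)

lemma theta_pq_scale: "theta_pq m n x y (\<lambda>i. s * p i) (\<lambda>j. s * q j)
    = s *\<^sub>R theta_pq m n x y p q"
  by (simp add: theta_pq_def scaleR_diff_right scaleR_sum_right)

lemma theta_pq_diff: "theta_pq m n x y (\<lambda>i. p i - p' i) (\<lambda>j. q j - q' j)
    = theta_pq m n x y p q - theta_pq m n x y p' q'"
  by (simp add: theta_pq_def scaleR_diff_left sum_subtractf algebra_simps)

lemma theta_hat_feasible:
  "0 < m \<Longrightarrow> 0 < n \<Longrightarrow>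
    feasible m n x y (theta_hat m n x y) (\<lambda>_. 1 / real m) (\<lambda>_. 1 / real n)"
  by (simp add: feasible_def theta_pq_uniform pos_weights_uniform)

lemma real_OEL_theta_hat:
  assumes mn: "0 < m" "0 < n"
  shows "theta_hat m n x y \<in> Theta m n x y" and "real_OEL m n x y (theta_hat m n x y) = 0"
proof -
  show in_Theta: "theta_hat m n x y \<in> Theta m n x y"
    using feasible_in_Theta[OF mn theta_hat_feasible[OF mn]] .
  show "real_OEL m n x y (theta_hat m n x y) = 0"
    using real_OEL_le[OF mn theta_hat_feasible[OF mn]] real_OEL_nonneg[OF mn in_Theta] mn
    by (metis add_0 antisym log_ratio_uniform mult_zero_right)
qed

lemma feasible_convex:
  assumes "feasible m n x y \<theta> p q" "feasible m n x y \<theta>' p' q'" "0 \<le> s" "s \<le> 1"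
  shows "feasible m n x y ((1 - s) *\<^sub>R \<theta> + s *\<^sub>R \<theta>')
    (\<lambda>i. (1 - s) * p i + s * p' i) (\<lambda>j. (1 - s) * q j + s * q' j)"
  using assms by (simp add: feasible_def pos_weights_convex theta_pq_add theta_pq_scale)

lemma real_OEL_convex:
  assumes mn: "0 < m" "0 < n"
  shows "convex_on (Theta m n x y) (real_OEL m n x y)"
proof -
  have combination: "(1 - s) *\<^sub>R \<theta> + s *\<^sub>R \<theta>' \<in> Theta m n x y \<and>
      real_OEL m n x y ((1 - s) *\<^sub>R \<theta> + s *\<^sub>R \<theta>')
        \<le> (1 - s) * real_OEL m n x y \<theta> + s * real_OEL m n x y \<theta>'"
    if s: "0 \<le> s" "s \<le> 1" and \<theta>: "\<theta> \<in> Theta m n x y" "\<theta>' \<in> Theta m n x y" for s \<theta> \<theta>'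
  proof
    show "(1 - s) *\<^sub>R \<theta> + s *\<^sub>R \<theta>' \<in> Theta m n x y"
      using near_optimal_weights[OF mn \<theta>(1), of 1] near_optimal_weights[OF mn \<theta>(2), of 1]
        feasible_in_Theta[OF mn feasible_convex] s by (metis zero_less_one)
    show "real_OEL m n x y ((1 - s) *\<^sub>R \<theta> + s *\<^sub>R \<theta>')
        \<le> (1 - s) * real_OEL m n x y \<theta> + s * real_OEL m n x y \<theta>'"
    proof (rule field_le_epsilon)
      fix e :: real assume e: "0 < e"
      obtain p q where pq: "feasible m n x y \<theta> p q"
        "- 2 * (log_ratio m p + log_ratio n q) < real_OEL m n x y \<theta> + e"
        using near_optimal_weights[OF mn \<theta>(1) e] by blast
      obtain p' q' where pq': "feasible m n x y \<theta>' p' q'"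
        "- 2 * (log_ratio m p' + log_ratio n q') < real_OEL m n x y \<theta>' + e"
        using near_optimal_weights[OF mn \<theta>(2) e] by blast
      let ?p = "\<lambda>i. (1 - s) * p i + s * p' i" and ?q = "\<lambda>j. (1 - s) * q j + s * q' j"
      have "real_OEL m n x y ((1 - s) *\<^sub>R \<theta> + s *\<^sub>R \<theta>') \<le> - 2 * (log_ratio m ?p + log_ratio n ?q)"
        using real_OEL_le[OF mn feasible_convex[OF pq(1) pq'(1) s]] .
      also have "\<dots> \<le> (1 - s) * (- 2 * (log_ratio m p + log_ratio n q))
          + s * (- 2 * (log_ratio m p' + log_ratio n q'))"
        using log_ratio_concave[of m p p' s] log_ratio_concave[of n q q' s] pq(1) pq'(1) s
        by (simp add: feasible_def algebra_simps)
      also have "\<dots> \<le> (1 - s) * (real_OEL m n x y \<theta> + e) + s * (real_OEL m n x y \<theta>' + e)"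
        using pq(2) pq'(2) s by (intro add_mono mult_left_mono) auto
      finally show "real_OEL m n x y ((1 - s) *\<^sub>R \<theta> + s *\<^sub>R \<theta>')
          \<le> (1 - s) * real_OEL m n x y \<theta> + s * real_OEL m n x y \<theta>' + e"
        by (simp add: algebra_simps)
    qed
  qed
  show ?thesis
  proof (intro convex_onI)
    show "convex (Theta m n x y)"
      unfolding convex_alt using combination by blast
  qed (use combination in auto)
qed

lemma theta_pq_norm_le:
  assumes "\<And>i. i \<in> {1..m} \<Longrightarrow> \<bar>p i\<bar> \<le> a" and "\<And>j. j \<in> {1..n} \<Longrightarrow> \<bar>q j\<bar> \<le> b"
  shows "norm (theta_pq m n x y p q) \<le> b * (\<Sum>j=1..n. norm (y j)) + a * (\<Sum>i=1..m. norm (x i))"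
proof -
  have "norm (\<Sum>j=1..n. q j *\<^sub>R y j) \<le> b * (\<Sum>j=1..n. norm (y j))"
    unfolding sum_distrib_left by (intro sum_norm_le) (auto intro!: mult_right_mono assms)
  moreover have "norm (\<Sum>i=1..m. p i *\<^sub>R x i) \<le> a * (\<Sum>i=1..m. norm (x i))"
    unfolding sum_distrib_left by (intro sum_norm_le) (auto intro!: mult_right_mono assms)
  ultimately show ?thesis
    unfolding theta_pq_def by (intro order_trans[OF norm_triangle_ineq4] add_mono)
qed

text \<open>At a zero of \<open>l\<close> there are weights with log-likelihood arbitrarily close to \<open>0\<close>, hence
  arbitrarily close to uniform, and \<open>theta_pq\<close> is Lipschitz in the weights.\<close>

lemma real_OEL_eq_0_iff:
  assumes mn: "0 < m" "0 < n" and \<theta>: "\<theta> \<in> Theta m n x y"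
  shows "real_OEL m n x y \<theta> = 0 \<longleftrightarrow> \<theta> = theta_hat m n x y"
proof
  assume zero: "real_OEL m n x y \<theta> = 0"
  define C where "C = (1 + sqrt (real n)) * (\<Sum>j=1..n. norm (y j))
    + (1 + sqrt (real m)) * (\<Sum>i=1..m. norm (x i))"
  have "0 \<le> C"
    unfolding C_def by (intro add_nonneg_nonneg mult_nonneg_nonneg sum_nonneg) auto
  have close: "norm (\<theta> - theta_hat m n x y) \<le> C * e" if "0 < e" for e
  proof -
    obtain p q where pq: "feasible m n x y \<theta> p q"
      "- 2 * (log_ratio m p + log_ratio n q) < 0 + 2 * e\<^sup>2"
      \<comment> \<open>The deviation bound is of the order of the square root of minus the log-likelihood.\<close>
      using near_optimal_weights[OF mn \<theta>, of "2 * e\<^sup>2"] zero \<open>0 < e\<close> by auto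
    have w: "pos_weights m p" "pos_weights n q" "theta_pq m n x y p q = \<theta>"
      using pq(1) by (auto simp: feasible_def)
    have "- log_ratio m p \<le> e\<^sup>2" "- log_ratio n q \<le> e\<^sup>2"
      using pq(2) log_ratio_nonpos[OF w(1) mn(1)] log_ratio_nonpos[OF w(2) mn(2)] by argo+
    then have "sqrt (- log_ratio m p) \<le> e" "sqrt (- log_ratio n q) \<le> e"
      using \<open>0 < e\<close> by (auto intro: real_le_lsqrt)
    then have m: "(1 + sqrt (real m)) * sqrt (- log_ratio m p) \<le> (1 + sqrt (real m)) * e"
      and n: "(1 + sqrt (real n)) * sqrt (- log_ratio n q) \<le> (1 + sqrt (real n)) * e"
      by (auto intro!: mult_left_mono)
    have "norm (theta_pq m n x y (\<lambda>i. p i - 1 / real m) (\<lambda>j. q j - 1 / real n))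
        \<le> (1 + sqrt (real n)) * e * (\<Sum>j=1..n. norm (y j))
          + (1 + sqrt (real m)) * e * (\<Sum>i=1..m. norm (x i))"
      by (rule theta_pq_norm_le[OF order_trans[OF weight_deviation_bound[OF w(1)] m]
            order_trans[OF weight_deviation_bound[OF w(2)] n]])
    also have "\<dots> = C * e"
      by (simp add: C_def algebra_simps)
    finally show ?thesis
      by (simp add: theta_pq_diff theta_pq_uniform w(3))
  qed
  have "norm (\<theta> - theta_hat m n x y) \<le> 0 + d" if "0 < d" for d
  proof -
    have "C * (d / (C + 1)) \<le> d"
      using \<open>0 < d\<close> \<open>0 \<le> C\<close> by (simp add: field_simps)
    then show ?thesis
      using close[of "d / (C + 1)"] \<open>0 < d\<close> \<open>0 \<le> C\<close> by simp
  qed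
  then have "norm (\<theta> - theta_hat m n x y) \<le> 0"
    by (rule field_le_epsilon)
  then show "\<theta> = theta_hat m n x y"
    by simp
next
  assume "\<theta> = theta_hat m n x y"
  then show "real_OEL m n x y \<theta> = 0"
    using real_OEL_theta_hat(2)[OF mn] by simp
qed

text \<open>
  Replacing a share \<open>s\<close> of uniform weights, contained in \<open>p\<close> and \<open>q\<close> by the lower bounds, with the
  weights of \<open>theta_hat + v\<close> moves the difference of weighted means by \<open>s *\<^sub>R v\<close>. The result stays
  strictly positive because the new share is.
\<close>

lemma feasible_shift:
  assumes pq: "feasible m n x y \<theta> p q" and ab: "feasible m n x y (theta_hat m n x y + v) a b"
    and mn: "0 < m" "0 < n" and "0 < s"
    and low: "\<And>i. i \<in> {1..m} \<Longrightarrow> s \<le> real m * p i" "\<And>j. j \<in> {1..n} \<Longrightarrow> s \<le> real n * q j"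
  shows "feasible m n x y (\<theta> + s *\<^sub>R v)
    (\<lambda>i. p i + s * (a i - 1 / real m)) (\<lambda>j. q j + s * (b j - 1 / real n))"
proof -
  have shift: "pos_weights k (\<lambda>i. p i + s * (a i - 1 / real k))"
    if p: "pos_weights k p" and a: "pos_weights k a" and "0 < k"
      and low: "\<And>i. i \<in> {1..k} \<Longrightarrow> s \<le> real k * p i" for k p a
  proof -
    have "0 < p i + s * (a i - 1 / real k)" if "i \<in> {1..k}" for i
    proof -
      have "s / real k \<le> p i"
        using low[OF that] \<open>0 < k\<close> by (simp add: divide_le_eq mult.commute)
      moreover have "0 < s * a i"
        using a that \<open>0 < s\<close> by (simp add: pos_weights_def)
      ultimately show ?thesis
        by (simp add: right_diff_distrib)
    qed
    moreover have "(\<Sum>i=1..k. p i + s * (a i - 1 / real k)) = 1"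
      using p a \<open>0 < k\<close> by (simp add: pos_weights_def sum.distrib sum_subtractf flip: sum_distrib_left)
    ultimately show ?thesis
      by (simp add: pos_weights_def)
  qed
  show ?thesis
    using pq ab mn low shift
    by (simp add: feasible_def theta_pq_add theta_pq_scale theta_pq_diff theta_pq_uniform)
qed

text \<open>
  On the sublevel set of \<open>L\<close> all near-optimal weights, rescaled by the sample sizes, have a common
  lower bound \<open>s\<close>. By \<open>feasible_shift\<close> a ball of radius \<open>\<epsilon>\<close> in \<open>\<Theta>\<close> around \<open>theta_hat\<close> is then transported to a
  ball of radius \<open>s * \<epsilon>\<close> around each point of the sublevel set.
\<close>

lemma real_OEL_sublevel_margin:
  assumes mn: "0 < m" "0 < n" and "open (Theta m n x y)"
  shows "\<exists>\<delta>>0. \<forall>\<theta>\<in>Theta m n x y. real_OEL m n x y \<theta> \<le> L \<longrightarrow> ball \<theta> \<delta> \<subseteq> Theta m n x y"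
proof -
  obtain \<epsilon> where \<epsilon>: "0 < \<epsilon>" "ball (theta_hat m n x y) \<epsilon> \<subseteq> Theta m n x y"
    using \<open>open (Theta m n x y)\<close> real_OEL_theta_hat(1)[OF mn] open_contains_ball by blast
  \<comment> \<open>Near-optimal weights within \<open>1\<close> of the infimum have log-likelihood at least \<open>- (L + 1) / 2\<close> in
    each sample, the other sample contributing at most \<open>0\<close>.\<close>
  define s where "s = exp (- (L + 1) / 2 - 1)"
  have "0 < s"
    by (simp add: s_def)
  have "w \<in> Theta m n x y"
    if \<theta>: "\<theta> \<in> Theta m n x y" "real_OEL m n x y \<theta> \<le> L" and w: "w \<in> ball \<theta> (s * \<epsilon>)" for \<theta> w
  proof -
    obtain p q where pq: "feasible m n x y \<theta> p q"
      "- 2 * (log_ratio m p + log_ratio n q) < real_OEL m n x y \<theta> + 1"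
      using near_optimal_weights[OF mn \<theta>(1), of 1] by auto
    have pw: "pos_weights m p" "pos_weights n q"
      using pq(1) by (auto simp: feasible_def)
    have "- (L + 1) / 2 \<le> log_ratio m p" "- (L + 1) / 2 \<le> log_ratio n q"
      using pq(2) \<theta>(2) log_ratio_nonpos[OF pw(1) mn(1)] log_ratio_nonpos[OF pw(2) mn(2)]
      by argo+
    then have "s \<le> exp (log_ratio m p - 1)" "s \<le> exp (log_ratio n q - 1)"
      by (auto simp: s_def)
    then have low: "i \<in> {1..m} \<Longrightarrow> s \<le> real m * p i" "j \<in> {1..n} \<Longrightarrow> s \<le> real n * q j" for i j
      using weight_lower_bound[OF pw(1), of i] weight_lower_bound[OF pw(2), of j] by linarith+
    define v where "v = (1 / s) *\<^sub>R (w - \<theta>)"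
    have "norm v < \<epsilon>"
      using w \<open>0 < s\<close>
      by (simp add: v_def dist_norm norm_minus_commute pos_divide_less_eq mult.commute)
    then have "theta_hat m n x y + v \<in> Theta m n x y"
      using \<epsilon>(2) by (auto simp: dist_norm)
    then obtain a b where "feasible m n x y (theta_hat m n x y + v) a b"
      using near_optimal_weights[OF mn] zero_less_one by metis
    from feasible_in_Theta[OF mn feasible_shift[OF pq(1) this mn \<open>0 < s\<close> low]]
    show ?thesis
      using \<open>0 < s\<close> by (simp add: v_def)
  qed
  then show ?thesis
    using \<epsilon>(1) \<open>0 < s\<close> by (intro exI[of _ "s * \<epsilon>"]) auto
qed


section \<open>The extended map\<close>

lemma similarity_on_OEL_contour:
  assumes mn: "0 < m" "0 < n"
  shows "similarity_on {\<theta> \<in> Theta m n x y. OEL m n x y \<theta> = ereal \<tau>} (h_C m n x y)"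
proof (cases "\<tau> < 0")
  \<comment> \<open>The contour is empty. The ratio is not the expansion factor here, as that may be negative.\<close>
  case True
  then have "{\<theta> \<in> Theta m n x y. OEL m n x y \<theta> = ereal \<tau>} = {}"
    using real_OEL_nonneg[OF mn] by force
  then show ?thesis
    by (auto simp: similarity_on_def intro: exI[of _ 1])
next
  case False
  define r where "r = expansion_factor (m + n) \<tau>"
  have "0 < r"
    using False by (simp add: r_def expansion_factor_def add_pos_nonneg)
  have "norm (h_C m n x y u - h_C m n x y v) = r * norm (u - v)"
    if "OEL m n x y u = ereal \<tau>" "OEL m n x y v = ereal \<tau>" for u v
  proof -
    have "h_C m n x y u - h_C m n x y v = r *\<^sub>R (u - v)"
      using that by (simp add: h_C_def r_def algebra_simps)
    then show ?thesis
      using \<open>0 < r\<close> by simp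
  qed
  then show ?thesis
    unfolding similarity_on_def using \<open>0 < r\<close> by blast
qed

lemma fixed_points_h_C:
  assumes mn: "0 < m" "0 < n"
  shows "{\<theta> \<in> Theta m n x y. h_C m n x y \<theta> = \<theta>} = {theta_hat m n x y}"
proof -
  have "h_C m n x y \<theta> = \<theta> \<longleftrightarrow> \<theta> = theta_hat m n x y" if \<theta>: "\<theta> \<in> Theta m n x y" for \<theta>
  proof -
    have "h_C m n x y \<theta> - \<theta> =
        (real_OEL m n x y \<theta> / (2 * real (m + n))) *\<^sub>R (\<theta> - theta_hat m n x y)"
      by (simp add: h_C_def expansion_factor_def algebra_simps)
    then have "h_C m n x y \<theta> = \<theta> \<longleftrightarrow>
        real_OEL m n x y \<theta> / (2 * real (m + n)) = 0 \<or> \<theta> - theta_hat m n x y = 0"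
      by (metis right_minus_eq scaleR_eq_0_iff)
    then show ?thesis
      using real_OEL_eq_0_iff[OF mn \<theta>] mn by auto
  qed
  then show ?thesis
    using real_OEL_theta_hat(1)[OF mn] by blast
qed

lemma bij_betw_h_C:
  assumes mn: "0 < m" "0 < n" and op: "open (Theta m n x y)"
  shows "bij_betw (h_C m n x y) (Theta m n x y) UNIV"
proof -
  have "h_C m n x y = (\<lambda>\<theta>. theta_hat m n x y +
      (1 + 1 / (2 * real (m + n)) * real_OEL m n x y \<theta>) *\<^sub>R (\<theta> - theta_hat m n x y))"
    by (simp add: fun_eq_iff h_C_def expansion_factor_def)
  then show ?thesis
    using radial_expansion_bij[OF op real_OEL_convex[OF mn] real_OEL_theta_hat[OF mn]
        real_OEL_nonneg[OF mn] real_OEL_sublevel_margin[OF mn op], of "1 / (2 * real (m + n))"] mn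
    by simp
qed

theorem theorem1:
  fixes M :: "'w measure"
    and X Y :: "'w \<Rightarrow> real ^ 'd"
    and Xs Ys :: "nat \<Rightarrow> 'w \<Rightarrow> real ^ 'd"
    and m n :: nat
  assumes "prob_space M"
    and "X \<in> borel_measurable M" and "Y \<in> borel_measurable M"
    and "prob_space.indep_vars M (\<lambda>_. borel) (case_sum Xs Ys) ({1..m} <+> {1..n})"
    and "\<And>i. i \<in> {1..m} \<Longrightarrow> distr M borel (Xs i) = distr M borel X"
    and "\<And>j. j \<in> {1..n} \<Longrightarrow> distr M borel (Ys j) = distr M borel Y"
    and "n \<le> m" and "CARD('d) < n"
    and "finite_cov M X" and "rank (cov_matrix M X) = CARD('d)"
    and "finite_cov M Y" and "rank (cov_matrix M Y) = CARD('d)"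
  shows "\<forall>\<omega>\<in>space M.
    let x = (\<lambda>i. Xs i \<omega>); y = (\<lambda>j. Ys j \<omega>); \<Theta> = Theta m n x y; h = h_C m n x y in
      open \<Theta> \<longrightarrow>
        {\<theta> \<in> \<Theta>. h \<theta> = \<theta>} = {theta_hat m n x y} \<and>
        (\<forall>\<tau>::real. similarity_on {\<theta> \<in> \<Theta>. OEL m n x y \<theta> = ereal \<tau>} h) \<and>
        bij_betw h \<Theta> UNIV"
proof -
  have mn: "0 < m" "0 < n"
    using \<open>n \<le> m\<close> \<open>CARD('d) < n\<close> by auto
  show ?thesis
    unfolding Let_def
    using fixed_points_h_C[OF mn] similarity_on_OEL_contour[OF mn] bij_betw_h_C[OF mn] by blast
qed

end
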